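(* For $\alpha=\pm$ and $1\le t\le p$ set $$e^{\alpha}(p,t)=\frac{1}{2p\prod_{i=1}^{p-1}(\alpha[i][p-i])}\,a_{t-1}^{\alpha}(p,t).$$ Then for $1\le t_1,t_2\le p$, $$e^{\alpha}(p,t_1)\,e^{\alpha}(p,t_2)=\begin{cases}e^{\alpha}(p,t_2),& t_1=t_2,\\ 0,&\text{otherwise.}\end{cases}$$ In particular, for $1\le t\le p$, each $e^{+}(p,t)$ is a primitive idempotent of $Q_p$ and each $e^{-}(p,t)$ is a primitive idempotent of $Q_0$.
   Context: Let $p\ge 2$ be an integer and $q=\exp(\pi\sqrt{-1}/p)$. $\overline{U}_q(sl_2)$ is the associative unital $\mathbb{C}$-algebra generated by $E,F,K,K^{-1}$ with relations $KK^{-1}=K^{-1}K=1$, $KEK^{-1}=q^2E$, $KFK^{-1}=q^{-2}F$, $EF-FE=\frac{K-K^{-1}}{q-q^{-1}}$, $E^p=F^p=0$, $K^{2p}=1$. Write $[n]=\frac{q^n-q^{-n}}{q-q^{-1}}$. A sign $\alpha\in\{+,-\}$ is identified with $\pm1$. The Casimir element $C=EF+\frac{q^{-1}K+qK^{-1}}{(q-q^{-1})^2}$ is central, and $\overline{U}_q(sl_2)=\bigoplus_{s=0}^pQ_s$ as algebras, where $Q_s$ is the generalized eigenspace of (multiplication by) $C$ with eigenvalue $\frac{q^s+q^{-s}}{(q-q^{-1})^2}$. For $1\le s,t\le p$: $v^\alpha(s,t)=\sum_{\ell=0}^{2p-1}(\alpha q^{-(s-2t+1)})^\ell K^\ell$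 and $a_n^\alpha(s,t)=F^nE^{p-1}F^{p-t}v^\alpha(s,t)$; here these are used with $s=p$. *)

theory Defs
  imports Complex_Main "HOL-Library.Poly_Mapping" "HOL-Algebra.QuotRing"
begin

section \<open>The free algebra on the four generators\<close>

datatype gen = Gen_E | Gen_F | Gen_K | Gen_Kinv

text \<open>The free monoid on the generators, written additively so that the convolution product
  of \<^theory>\<open>HOL-Library.Poly_Mapping\<close> turns finitely supported complex functions on it into
  the free unital complex algebra.\<close>

datatype gen_word = Word "gen list"

instantiation gen_word :: monoid_add
begin

definition zero_gen_word :: gen_word where
  "zero_gen_word = Word []"

fun plus_gen_word :: "gen_word \<Rightarrow> gen_word \<Rightarrow> gen_word" where
  "plus_gen_word (Word u) (Word v) = Word (u @ v)"

instance
proof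
  fix a b c :: gen_word
  show "a + b + c = a + (b + c)" by (cases a; cases b; cases c) simp
  show "0 + a = a" by (cases a) (simp add: zero_gen_word_def)
  show "a + 0 = a" by (cases a) (simp add: zero_gen_word_def)
qed

end

type_synonym free_alg = "gen_word \<Rightarrow>\<^sub>0 complex"

definition free_gen :: "gen \<Rightarrow> free_alg" where
  "free_gen g = Poly_Mapping.single (Word [g]) 1"

definition free_const :: "complex \<Rightarrow> free_alg" where
  "free_const c = Poly_Mapping.single 0 c"

definition free_ring :: "free_alg ring" where
  "free_ring = \<lparr>carrier = UNIV, mult = (*), one = 1, zero = 0, add = (+)\<rparr>"

lemma ring_free_ring: "ring free_ring"
proof (rule ringI)
  show "abelian_group free_ring"
  proof (rule abelian_groupI)
    fix x assume "x \<in> carrier free_ring"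
    show "\<exists>y\<in>carrier free_ring. y \<oplus>\<^bsub>free_ring\<^esub> x = \<zero>\<^bsub>free_ring\<^esub>"
      by (rule bexI[of _ "- x"]) (auto simp: free_ring_def)
  qed (auto simp: free_ring_def algebra_simps)
  show "monoid free_ring"
    by (rule monoidI) (auto simp: free_ring_def algebra_simps)
qed (auto simp: free_ring_def algebra_simps)


section \<open>The restricted quantum group\<close>

definition qq :: "nat \<Rightarrow> complex" where
  "qq p = exp (of_real pi * \<i> / of_nat p)"

definition qint :: "nat \<Rightarrow> nat \<Rightarrow> complex" where
  "qint p n = (qq p powi int n - qq p powi (- int n)) / (qq p - inverse (qq p))"

text \<open>Each element stands for the defining relation that it vanishes.\<close>

definition uq_relators :: "nat \<Rightarrow> free_alg set" where
  "uq_relators p =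
    (let E = free_gen Gen_E; F = free_gen Gen_F; K = free_gen Gen_K; Ki = free_gen Gen_Kinv;
         q = qq p
     in {K * Ki - 1,
         Ki * K - 1,
         K * E * Ki - free_const (q ^ 2) * E,
         K * F * Ki - free_const (inverse (q ^ 2)) * F,
         E * F - F * E - free_const (1 / (q - inverse q)) * (K - Ki),
         E ^ p,
         F ^ p,
         K ^ (2 * p) - 1})"

definition Uq :: "nat \<Rightarrow> free_alg set ring" where
  "Uq p = free_ring Quot (Idl\<^bsub>free_ring\<^esub> (uq_relators p))"

lemma ring_Uq: "ring (Uq p)"
  unfolding Uq_def
  by (intro ideal.quotient_is_ring ring.genideal_ideal ring_free_ring)
     (simp add: free_ring_def)

definition uq_cls :: "nat \<Rightarrow> free_alg \<Rightarrow> free_alg set" where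
  "uq_cls p x = (Idl\<^bsub>free_ring\<^esub> (uq_relators p)) +>\<^bsub>free_ring\<^esub> x"

definition uE :: "nat \<Rightarrow> free_alg set" where "uE p = uq_cls p (free_gen Gen_E)"
definition uF :: "nat \<Rightarrow> free_alg set" where "uF p = uq_cls p (free_gen Gen_F)"
definition uK :: "nat \<Rightarrow> free_alg set" where "uK p = uq_cls p (free_gen Gen_K)"
definition uKinv :: "nat \<Rightarrow> free_alg set" where "uKinv p = uq_cls p (free_gen Gen_Kinv)"

definition uq_scale :: "nat \<Rightarrow> complex \<Rightarrow> free_alg set \<Rightarrow> free_alg set" where
  "uq_scale p c x = uq_cls p (free_const c) \<otimes>\<^bsub>Uq p\<^esub> x"


section \<open>The Casimir element and the algebras \<open>Q\<^sub>s\<close>\<close>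

definition casimir :: "nat \<Rightarrow> free_alg set" where
  "casimir p =
    uE p \<otimes>\<^bsub>Uq p\<^esub> uF p \<oplus>\<^bsub>Uq p\<^esub>
    uq_scale p (1 / (qq p - inverse (qq p)) ^ 2)
      (uq_scale p (inverse (qq p)) (uK p) \<oplus>\<^bsub>Uq p\<^esub> uq_scale p (qq p) (uKinv p))"

definition casimir_eigenvalue :: "nat \<Rightarrow> nat \<Rightarrow> complex" where
  "casimir_eigenvalue p s =
    (qq p powi int s + qq p powi (- int s)) / (qq p - inverse (qq p)) ^ 2"

definition Q_space :: "nat \<Rightarrow> nat \<Rightarrow> free_alg set set" where
  "Q_space p s =
    {x \<in> carrier (Uq p). \<exists>n::nat.
       ((casimir p \<ominus>\<^bsub>Uq p\<^esub> uq_scale p (casimir_eigenvalue p s) \<one>\<^bsub>Uq p\<^esub>) [^]\<^bsub>Uq p\<^esub> n)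
         \<otimes>\<^bsub>Uq p\<^esub> x = \<zero>\<^bsub>Uq p\<^esub>}"

text \<open>The summand \<open>Q\<^sub>s\<close> carries the operations of the whole algebra, but its unit is its own.\<close>

definition Q :: "nat \<Rightarrow> nat \<Rightarrow> free_alg set ring" where
  "Q p s = (Uq p)\<lparr>carrier := Q_space p s,
     one := (THE u. u \<in> Q_space p s \<and>
       (\<forall>x\<in>Q_space p s. u \<otimes>\<^bsub>Uq p\<^esub> x = x \<and> x \<otimes>\<^bsub>Uq p\<^esub> u = x))\<rparr>"

definition idempotent_in :: "('a, 'b) ring_scheme \<Rightarrow> 'a \<Rightarrow> bool" where
  "idempotent_in R e \<longleftrightarrow> e \<in> carrier R \<and> e \<otimes>\<^bsub>R\<^esub> e = e"

definition primitive_idempotent :: "('a, 'b) ring_scheme \<Rightarrow> 'a \<Rightarrow> bool" where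
  "primitive_idempotent R e \<longleftrightarrow>
    idempotent_in R e \<and> e \<noteq> \<zero>\<^bsub>R\<^esub> \<and>
    (\<forall>f g. idempotent_in R f \<and> idempotent_in R g \<and>
       f \<otimes>\<^bsub>R\<^esub> g = \<zero>\<^bsub>R\<^esub> \<and> g \<otimes>\<^bsub>R\<^esub> f = \<zero>\<^bsub>R\<^esub> \<and> e = f \<oplus>\<^bsub>R\<^esub> g
       \<longrightarrow> f = \<zero>\<^bsub>R\<^esub> \<or> g = \<zero>\<^bsub>R\<^esub>)"


section \<open>The elements \<open>v\<close>, \<open>a\<^sub>n\<close> and \<open>e\<close>\<close>

text \<open>The sign \<open>\<alpha>\<close> is passed as the complex number 1 or -1.\<close>

definition v_elt :: "nat \<Rightarrow> complex \<Rightarrow> nat \<Rightarrow> nat \<Rightarrow> free_alg set" where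
  "v_elt p \<alpha> s t =
    (\<Oplus>\<^bsub>Uq p\<^esub> l \<in> {..<2 * p}.
       uq_scale p ((\<alpha> * qq p powi (- (int s - 2 * int t + 1))) ^ l) (uK p [^]\<^bsub>Uq p\<^esub> (l::nat)))"

definition a_elt :: "nat \<Rightarrow> complex \<Rightarrow> nat \<Rightarrow> nat \<Rightarrow> nat \<Rightarrow> free_alg set" where
  "a_elt p \<alpha> n s t =
    (uF p [^]\<^bsub>Uq p\<^esub> n) \<otimes>\<^bsub>Uq p\<^esub> (uE p [^]\<^bsub>Uq p\<^esub> (p - 1)) \<otimes>\<^bsub>Uq p\<^esub>
    (uF p [^]\<^bsub>Uq p\<^esub> (p - t)) \<otimes>\<^bsub>Uq p\<^esub> v_elt p \<alpha> s t"

definition e_elt :: "nat \<Rightarrow> complex \<Rightarrow> nat \<Rightarrow> free_alg set" where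
  "e_elt p \<alpha> t =
    uq_scale p (1 / (2 * of_nat p * (\<Prod>i\<in>{1..p-1}. \<alpha> * qint p i * qint p (p - i))))
      (a_elt p \<alpha> (t - 1) p t)"

end

theory Submission
  imports Defs
begin

text \<open>Let \<open>w = E\<^sup>p\<^sup>-\<^sup>1 F\<^sup>p\<^sup>-\<^sup>t v\<close>, so that \<open>e(t)\<close> is a multiple of \<open>F\<^sup>t\<^sup>-\<^sup>1 w\<close>. Up to the factor \<open>2p\<close>,
  left multiplication by \<open>v\<close> projects onto a \<open>K\<close>-eigenspace. The element \<open>w\<close> is a highest weight vector,
  hence \<open>E F\<^sup>i w = \<alpha>[i][p-i] F\<^sup>i\<^sup>-\<^sup>1 w\<close>, the left ideal generated by \<open>w\<close> is spanned by the
  \<open>F\<^sup>i w\<close>, and left multiplication by \<open>e(t)\<close> fixes \<open>F\<^sup>t\<^sup>-\<^sup>1 w\<close> and kills the other \<open>F\<^sup>i w\<close>. This gives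
  orthogonality and shows that \<open>e(t)\<close> spans the corner \<open>e(t) U e(t)\<close>. Primitivity follows once
  \<open>e(t)\<close> is nonzero, which is visible in the \<open>p\<close>-dimensional simple module. The Casimir element acts
  on \<open>w\<close> by its eigenvalue \<open>\<alpha>(q\<^sup>p + q\<^sup>-\<^sup>p)/(q - q\<^sup>-\<^sup>1)\<^sup>2\<close>.\<close>

section \<open>The quotient map as a ring homomorphism\<close>

text \<open>Scalar multiplication on representatives: computations run in the ring type
  \<open>free_alg\<close>, and only equality is taken modulo the ideal.\<close>

definition scale :: "complex \<Rightarrow> free_alg \<Rightarrow> free_alg" where
  "scale c x = free_const c * x"

lemma free_alg_induct [case_names zero add]:
  fixes x :: free_alg
  assumes "P 0" and "\<And>u c x. P x \<Longrightarrow> P (Poly_Mapping.single (Word u) c + x)"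
  shows "P x"
proof (induction x rule: update_induct)
  case const
  then show ?case using assms(1) by simp
next
  case (update f a b)
  have "Poly_Mapping.update a b f = Poly_Mapping.single a b + f"
    using update by (intro poly_mapping_eqI)
      (auto simp: lookup_update lookup_add lookup_single when_def in_keys_iff)
  then show ?case
    using assms(2) update by (cases a) simp
qed

text \<open>Constants are supported on the empty word, which is neutral for concatenation.\<close>

lemma free_const_commute: "x * free_const c = free_const c * x"
  by (induction x rule: free_alg_induct)
    (simp_all add: free_const_def algebra_simps mult_single)

lemma scale_mult_left: "scale c x * y = scale c (x * y)"
  by (simp add: scale_def mult.assoc)

lemma scale_mult_right: "x * scale c y = scale c (x * y)"
  by (simp add: scale_def mult.assoc [symmetric] free_const_commute)

interpretation scale: vector_space scale
proof
  fix a b :: complex and x y :: free_alg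
  show "scale a (scale b x) = scale (a * b) x"
    by (simp add: scale_def free_const_def mult.assoc [symmetric] mult_single)
qed (simp_all add: scale_def free_const_def algebra_simps single_add)

lemmas scale_simps = scale_mult_left scale_mult_right scale.scale_scale

lemma single_Word_Cons:
  "Poly_Mapping.single (Word (g # u)) c = free_gen g * Poly_Mapping.single (Word u) c"
  by (simp add: free_gen_def mult_single)

lemma single_Word_Nil: "Poly_Mapping.single (Word []) c = scale c 1"
  by (simp add: scale_def free_const_def zero_gen_word_def)

section \<open>The defining ideal and its cosets\<close>

lemma ideal_uq: "ideal (Idl\<^bsub>free_ring\<^esub> (uq_relators p)) free_ring"
  by (intro ring.genideal_ideal ring_free_ring) (simp add: free_ring_def)

lemma uq_relators_in_ideal: "x \<in> uq_relators p \<Longrightarrow> x \<in> Idl\<^bsub>free_ring\<^esub> (uq_relators p)"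
  using ring.genideal_self [OF ring_free_ring, of "uq_relators p"] by (auto simp: free_ring_def)

lemma free_ring_simps [simp]:
  "carrier free_ring = UNIV" "x \<otimes>\<^bsub>free_ring\<^esub> y = x * y" "x \<oplus>\<^bsub>free_ring\<^esub> y = x + y"
  "\<one>\<^bsub>free_ring\<^esub> = 1" "\<zero>\<^bsub>free_ring\<^esub> = 0"
  by (simp_all add: free_ring_def)

lemma free_ring_a_inv [simp]: "\<ominus>\<^bsub>free_ring\<^esub> x = - x"
proof -
  interpret ring free_ring by (rule ring_free_ring)
  show ?thesis by (rule minus_equality) auto
qed

lemma free_ring_a_minus [simp]: "x \<ominus>\<^bsub>free_ring\<^esub> y = x - y"
  by (simp add: a_minus_def)

lemma uq_cls_hom: "ring_hom_ring free_ring (Uq p) (uq_cls p)"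
proof -
  interpret ideal "Idl\<^bsub>free_ring\<^esub> (uq_relators p)" free_ring by (rule ideal_uq)
  have "uq_cls p = (+>\<^bsub>free_ring\<^esub>) (Idl\<^bsub>free_ring\<^esub> (uq_relators p))"
    by (simp add: fun_eq_iff uq_cls_def)
  then show ?thesis
    using rcos_ring_hom_ring by (simp add: Uq_def)
qed

text \<open>Turns identities in \<open>Uq p\<close> into ideal membership: the defining relations
  enter this way, and so does the descent of \<open>act\<close> to the quotient.\<close>

lemma uq_cls_eq_iff: "uq_cls p x = uq_cls p y \<longleftrightarrow> x - y \<in> Idl\<^bsub>free_ring\<^esub> (uq_relators p)"
proof -
  interpret ideal "Idl\<^bsub>free_ring\<^esub> (uq_relators p)" free_ring by (rule ideal_uq)
  show ?thesis
    using quotient_eq_iff_same_a_r_cos [OF ideal_uq, of x y] by (simp add: uq_cls_def)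
qed

lemma carrier_Uq: "carrier (Uq p) = range (uq_cls p)"
  by (auto simp: Uq_def uq_cls_def FactRing_def A_RCOSETS_defs a_r_coset_def)

context
  fixes p :: nat
begin

interpretation cls: ring_hom_ring free_ring "Uq p" "uq_cls p"
  by (rule uq_cls_hom)

lemma uq_cls_mult: "uq_cls p x \<otimes>\<^bsub>Uq p\<^esub> uq_cls p y = uq_cls p (x * y)"
  using cls.hom_mult [of x y] by simp

lemma uq_cls_add: "uq_cls p x \<oplus>\<^bsub>Uq p\<^esub> uq_cls p y = uq_cls p (x + y)"
  using cls.hom_add [of x y] by simp

lemma uq_cls_one: "\<one>\<^bsub>Uq p\<^esub> = uq_cls p 1"
  using cls.hom_one by simp

lemma uq_cls_zero: "\<zero>\<^bsub>Uq p\<^esub> = uq_cls p 0"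
  using cls.hom_zero by simp

lemma uq_cls_minus: "uq_cls p x \<ominus>\<^bsub>Uq p\<^esub> uq_cls p y = uq_cls p (x - y)"
  using cls.hom_add [of x "- y"] cls.hom_a_inv [of y] by (simp add: a_minus_def)

lemma uq_cls_power: "uq_cls p x [^]\<^bsub>Uq p\<^esub> (n::nat) = uq_cls p (x ^ n)"
  by (induction n) (simp_all add: uq_cls_mult uq_cls_one power_commutes)

lemma uq_cls_scale: "uq_scale p c (uq_cls p x) = uq_cls p (scale c x)"
  by (simp add: uq_scale_def uq_cls_mult scale_def)

lemma uq_cls_finsum: "(\<Oplus>\<^bsub>Uq p\<^esub>i\<in>A. uq_cls p (f i)) = uq_cls p (\<Sum>i\<in>A. f i)"
proof (cases "finite A")
  case True
  then show ?thesis
    by (induction) (simp_all add: uq_cls_zero uq_cls_add)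
qed (simp add: uq_cls_zero)

end

lemmas uq_cls_simps =
  uq_cls_mult uq_cls_add uq_cls_minus uq_cls_power uq_cls_scale uq_cls_finsum

section \<open>Quantum integers\<close>

abbreviation "gE \<equiv> free_gen Gen_E"
abbreviation "gF \<equiv> free_gen Gen_F"
abbreviation "gK \<equiv> free_gen Gen_K"
abbreviation "gKi \<equiv> free_gen Gen_Kinv"

lemma qq_nonzero [simp]: "qq p \<noteq> 0"
  by (simp add: qq_def)

lemma qq_power: "qq p ^ n = cis (pi * n / p)"
  by (simp add: qq_def exp_of_nat_mult [symmetric] cis_conv_exp field_simps)

lemma qq_power_p: "p > 0 \<Longrightarrow> qq p ^ p = -1"
  by (simp add: qq_power)

text \<open>\<open>qq p\<close> is a primitive \<open>2p\<close>-th root of unity: a power with real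
  part 1 has its angle \<open>pi * n / p\<close> in the integer multiples of
  \<open>2 * pi\<close>.\<close>

lemma qq_power_eq_1_iff:
  assumes "p > 0"
  shows "qq p ^ n = 1 \<longleftrightarrow> 2 * p dvd n"
proof
  assume "qq p ^ n = 1"
  then have "cos (pi * n / p) = 1"
    by (metis qq_power cis.simps(1) one_complex.simps(1))
  then obtain k :: int where "pi * n / p = k * 2 * pi"
    by (auto simp: cos_one_2pi_int)
  then have "pi * real n = pi * (2 * p * k)"
    using assms by (simp add: field_simps)
  then have "real_of_int (int n) = real_of_int (int (2 * p) * k)"
    by simp
  then have "int n = int (2 * p) * k"
    by (simp only: of_int_eq_iff)
  then show "2 * p dvd n"
    by (metis dvd_triv_left int_dvd_int_iff)
next
  assume "2 * p dvd n"
  then obtain k where "n = 2 * p * k" by (rule dvdE)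
  then show "qq p ^ n = 1"
    using assms by (simp add: power_mult power2_eq_square power_mult_distrib qq_power_p)
qed

lemma qq_powi_eq_1_iff: "p > 0 \<Longrightarrow> qq p powi n = 1 \<longleftrightarrow> int (2 * p) dvd n"
  by (cases n rule: int_cases2)
    (simp_all add: power_int_minus qq_power_eq_1_iff del: of_nat_mult)

lemma qq_diff_inverse_nonzero: "p \<ge> 2 \<Longrightarrow> qq p - inverse (qq p) \<noteq> 0"
proof
  assume p: "p \<ge> 2" and "qq p - inverse (qq p) = 0"
  then have "qq p ^ 2 = 1" by (simp add: field_simps power2_eq_square)
  with p show False by (auto simp: qq_power_eq_1_iff dest: dvd_imp_le)
qed

text \<open>A zero would force \<open>qq p ^ (2 * n) = 1\<close> although
  \<open>0 < 2 * n < 2 * p\<close>.\<close>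

lemma qint_nonzero:
  assumes "0 < n" "n < p"
  shows "qint p n \<noteq> 0"
proof
  have p: "p \<ge> 2" using assms by simp
  assume "qint p n = 0"
  then have "qq p ^ n * qq p ^ n = 1"
    using qq_diff_inverse_nonzero [OF p] by (simp add: qint_def power_int_minus field_simps)
  then have "2 * p dvd n + n"
    using p by (simp flip: power_add add: qq_power_eq_1_iff)
  then show False
    using assms by (auto dest: dvd_imp_le)
qed

lemma qint_0 [simp]: "qint p 0 = 0"
  by (simp add: qint_def)

text \<open>Removes the truncated subtraction and leaves a rational expression in
  \<open>qq p ^ p\<close> and \<open>qq p ^ i\<close>.\<close>

lemma qint_complement:
  assumes "i \<le> p"
  shows "qint p (p - i) = (qq p ^ p / qq p ^ i - qq p ^ i / qq p ^ p) / (qq p - inverse (qq p))"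
proof -
  have "qq p ^ (p - i) = qq p ^ p / qq p ^ i"
    using assms by (intro power_diff) auto
  then show ?thesis
    unfolding qint_def power_int_minus power_int_of_nat by simp
qed

lemma qint_altdef: "qint p i = (qq p ^ i - inverse (qq p ^ i)) / (qq p - inverse (qq p))"
  unfolding qint_def power_int_minus power_int_of_nat by simp

lemma qq_powi_weight: "qq p powi (int p - 1 - 2 * int i) = qq p ^ p / qq p / qq p ^ i / qq p ^ i"
proof -
  have "int p - 1 - 2 * int i = int p - int 1 - int i - int i" by simp
  \<comment> \<open>This is the side condition of \<open>power_int_diff\<close>.\<close>
  moreover have "qq p \<noteq> 0 \<or> m \<noteq> n" for m n :: int by simp
  ultimately show ?thesis
    by (simp only: power_int_diff power_int_of_nat power_one_right)
qed

text \<open>The added fraction is the quantum integer [p-1-2i], the contribution of one commutator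
  of E and F. Written in a = q^i and b = q^p, the claim is an identity of rational functions in a, b
  and q.\<close>

lemma qint_product_step:
  assumes "i < p" "p \<ge> 2"
  shows "qint p i * qint p (p - i) +
      (qq p powi (int p - 1 - 2 * int i) - inverse (qq p powi (int p - 1 - 2 * int i))) /
        (qq p - inverse (qq p))
    = qint p (i + 1) * qint p (p - (i + 1))"
proof -
  define q a b d where "q = qq p" and "a = q ^ i" and "b = q ^ p" and "d = q - inverse q"
  have nz: "q \<noteq> 0" "a \<noteq> 0" "b \<noteq> 0" "d \<noteq> 0"
    using qq_diff_inverse_nonzero [OF assms(2)] by (simp_all add: q_def a_def b_def d_def)
  have "(a - inverse a) * (b / a - a / b) + (b / q / a / a - inverse (b / q / a / a)) * d
      = (a * q - inverse (a * q)) * (b / (a * q) - (a * q) / b)"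
    using nz(1-3) unfolding d_def by (simp add: field_simps)
  moreover have "x / d * (y / d) + z / d = (x * y + z * d) / (d * d)" for x y z
    using nz by (simp add: field_simps)
  ultimately have "(a - inverse a) / d * ((b / a - a / b) / d) + (b / q / a / a - inverse (b / q / a / a)) / d
      = (a * q - inverse (a * q)) / d * ((b / (a * q) - a * q / b) / d)"
    by simp
  moreover have "i \<le> p" "i + 1 \<le> p" using assms by simp_all
  ultimately show ?thesis
    by (simp only: qint_complement qint_altdef [of p i] qint_altdef [of p "i + 1"] qq_powi_weight
        a_def b_def d_def q_def power_add power_one_right)
qed

text \<open>The Casimir eigenvalue on the i-th vector of an F-string, before the sign is multiplied
  in. It is the same for all i, and q^p = -1 makes its numerator -2.\<close>

lemma qint_product_casimir:
  assumes "i < p"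
  shows "qint p (i + 1) * qint p (p - (i + 1)) +
      (inverse (qq p) * qq p powi (int p - 1 - 2 * int i) +
        qq p * inverse (qq p powi (int p - 1 - 2 * int i))) / (qq p - inverse (qq p)) ^ 2
    = - 2 / (qq p - inverse (qq p)) ^ 2"
proof -
  define q a b d where "q = qq p" and "a = q ^ i" and "b = q ^ p" and "d = q - inverse q"
  have nz: "q \<noteq> 0" "a \<noteq> 0"
    by (simp_all add: q_def a_def)
  have b: "b = - 1"
    using assms by (simp add: b_def q_def qq_power_p)
  have "(a * q - inverse (a * q)) * (b / (a * q) - a * q / b)
      + (inverse q * (b / q / a / a) + q * inverse (b / q / a / a)) = - 2"
    using nz unfolding b by (simp add: field_simps)
  then have "(a * q - inverse (a * q)) / d * ((b / (a * q) - a * q / b) / d)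
      + (inverse q * (b / q / a / a) + q * inverse (b / q / a / a)) / d ^ 2 = - 2 / d ^ 2"
    by (simp only: power2_eq_square times_divide_times_eq flip: add_divide_distrib)
  moreover have "i + 1 \<le> p" using assms by simp
  ultimately show ?thesis
    by (simp only: qint_complement qint_altdef [of p "i + 1"] qq_powi_weight
        a_def b_def d_def q_def power_add power_one_right)
qed

section \<open>Weight vectors\<close>

lemma uq_cls_mult_left: "uq_cls p x = uq_cls p y \<Longrightarrow> uq_cls p (z * x) = uq_cls p (z * y)"
  by (simp flip: uq_cls_mult)

lemma uq_cls_mult_right: "uq_cls p x = uq_cls p y \<Longrightarrow> uq_cls p (x * z) = uq_cls p (y * z)"
  by (simp flip: uq_cls_mult)

lemma uq_cls_add_cong:
  "uq_cls p x = uq_cls p x' \<Longrightarrow> uq_cls p y = uq_cls p y' \<Longrightarrow> uq_cls p (x + y) = uq_cls p (x' + y')"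
  by (simp flip: uq_cls_add)

lemma uq_cls_diff_cong:
  "uq_cls p x = uq_cls p x' \<Longrightarrow> uq_cls p y = uq_cls p y' \<Longrightarrow> uq_cls p (x - y) = uq_cls p (x' - y')"
  by (simp flip: uq_cls_minus)

lemma uq_cls_scale_cong: "uq_cls p x = uq_cls p y \<Longrightarrow> uq_cls p (scale c x) = uq_cls p (scale c y)"
  by (simp flip: uq_cls_scale)

lemma uq_cls_sum_cong:
  "(\<And>i. i \<in> A \<Longrightarrow> uq_cls p (f i) = uq_cls p (g i)) \<Longrightarrow> uq_cls p (sum f A) = uq_cls p (sum g A)"
  by (induction A rule: infinite_finite_induct) (simp_all flip: uq_cls_add)

locale signed_parameter =
  fixes p :: nat and \<alpha> :: complex
  assumes p2: "p \<ge> 2" and sign: "\<alpha> \<in> {1, -1}"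
begin

abbreviation cong :: "free_alg \<Rightarrow> free_alg \<Rightarrow> bool" (infix "\<approx>" 50) where
  "x \<approx> y \<equiv> uq_cls p x = uq_cls p y"

abbreviation q :: complex where "q \<equiv> qq p"

lemma sign_nonzero [simp]: "\<alpha> \<noteq> 0" and sign_square [simp]: "\<alpha> * \<alpha> = 1"
  and inverse_sign [simp]: "inverse \<alpha> = \<alpha>"
  using sign by auto

lemma relations:
  "gK * gKi \<approx> 1" "gKi * gK \<approx> 1"
  "gK * gE * gKi \<approx> scale (q ^ 2) gE" "gK * gF * gKi \<approx> scale (inverse (q ^ 2)) gF"
  "gE * gF - gF * gE \<approx> scale (1 / (q - inverse q)) (gK - gKi)"
  "gE ^ p \<approx> 0" "gF ^ p \<approx> 0" "gK ^ (2 * p) \<approx> 1"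
  unfolding uq_cls_eq_iff scale_def
  by (rule uq_relators_in_ideal; simp add: uq_relators_def Let_def)+

text \<open>Inserting \<open>gKi * gK\<close> on the right turns a conjugation relation into a
  commutation rule.\<close>

lemma K_move:
  assumes "gK * x * gKi \<approx> scale c x"
  shows "gK * x \<approx> scale c (x * gK)"
proof -
  have "gK * x = gK * x * 1" by simp
  also have "\<dots> \<approx> gK * x * (gKi * gK)"
    by (rule uq_cls_mult_left, rule relations(2) [symmetric])
  also have "gK * x * (gKi * gK) = (gK * x * gKi) * gK" by (simp add: mult.assoc)
  also have "\<dots> \<approx> scale c x * gK" by (rule uq_cls_mult_right, rule assms)
  finally show ?thesis by (simp add: scale_simps)
qed

text \<open>The sign is part of the eigenvalue, so that weights are integers and E, F shift them by
  2 and -2 for both signs.\<close>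

definition weight :: "int \<Rightarrow> free_alg \<Rightarrow> bool" where
  "weight m x \<longleftrightarrow> gK * x \<approx> scale (\<alpha> * q powi m) x"

lemma weight_gen:
  assumes g: "gK * g * gKi \<approx> scale (q powi k) g" and x: "weight m x"
  shows "weight (m + k) (g * x)"
proof -
  have "gK * (g * x) = (gK * g) * x" by (simp add: mult.assoc)
  also have "\<dots> \<approx> scale (q powi k) (g * gK) * x"
    by (intro uq_cls_mult_right K_move g)
  also have "scale (q powi k) (g * gK) * x = scale (q powi k) (g * (gK * x))"
    by (simp add: scale_simps mult.assoc)
  also have "\<dots> \<approx> scale (q powi k) (g * scale (\<alpha> * q powi m) x)"
    using x by (intro uq_cls_scale_cong uq_cls_mult_left) (simp add: weight_def)
  also have "scale (q powi k) (g * scale (\<alpha> * q powi m) x) = scale (\<alpha> * q powi (m + k)) (g * x)"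
    by (simp add: scale_simps power_int_add mult_ac)
  finally show ?thesis by (simp add: weight_def)
qed

lemma weight_E: "weight m x \<Longrightarrow> weight (m + 2) (gE * x)"
  using relations(3) by (intro weight_gen) simp_all

lemma weight_F: "weight m x \<Longrightarrow> weight (m - 2) (gF * x)"
  using relations(4) weight_gen [of gF "-2" m x] by (simp add: power_int_minus)

lemma weight_E_power: "weight m x \<Longrightarrow> weight (m + 2 * int n) (gE ^ n * x)"
proof (induction n)
  case (Suc n)
  then have "weight (m + 2 * int n + 2) (gE * (gE ^ n * x))" by (intro weight_E)
  then show ?case by (simp add: mult.assoc algebra_simps)
qed simp

lemma weight_F_power: "weight m x \<Longrightarrow> weight (m - 2 * int n) (gF ^ n * x)"
proof (induction n)
  case (Suc n)
  then have "weight (m - 2 * int n - 2) (gF * (gF ^ n * x))" by (intro weight_F)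
  then show ?case by (simp add: mult.assoc algebra_simps)
qed simp

lemma weight_K_power:
  assumes "weight m x"
  shows "gK ^ n * x \<approx> scale ((\<alpha> * q powi m) ^ n) x"
proof (induction n)
  case (Suc n)
  have "gK ^ Suc n * x = gK * (gK ^ n * x)" by (simp add: mult.assoc)
  also have "\<dots> \<approx> gK * scale ((\<alpha> * q powi m) ^ n) x" by (intro uq_cls_mult_left Suc)
  also have "gK * scale ((\<alpha> * q powi m) ^ n) x = scale ((\<alpha> * q powi m) ^ n) (gK * x)"
    by (simp add: scale_simps)
  also have "\<dots> \<approx> scale ((\<alpha> * q powi m) ^ n) (scale (\<alpha> * q powi m) x)"
    using assms by (intro uq_cls_scale_cong) (simp add: weight_def)
  finally show ?case by (simp add: scale_simps mult_ac)
qed simp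

lemma weight_Kinv:
  assumes "weight m x"
  shows "gKi * x \<approx> scale (\<alpha> * inverse (q powi m)) x"
proof -
  \<comment> \<open>The two scalars cancel because \<open>\<alpha> * \<alpha> = 1\<close>; the inner
    one is introduced so that it can be traded for \<open>gK\<close>.\<close>
  have "gKi * x = scale (\<alpha> * inverse (q powi m)) (gKi * scale (\<alpha> * q powi m) x)"
    by (simp add: scale_simps field_simps)
  also have "\<dots> \<approx> scale (\<alpha> * inverse (q powi m)) (gKi * (gK * x))"
    using assms by (intro uq_cls_scale_cong uq_cls_mult_left) (simp add: weight_def)
  also have "scale (\<alpha> * inverse (q powi m)) (gKi * (gK * x))
      = scale (\<alpha> * inverse (q powi m)) (gKi * gK * x)" by (simp add: mult.assoc)
  also have "\<dots> \<approx> scale (\<alpha> * inverse (q powi m)) (1 * x)"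
    by (intro uq_cls_scale_cong uq_cls_mult_right relations)
  finally show ?thesis by simp
qed

section \<open>The projector onto an eigenspace of K\<close>

definition free_v :: "nat \<Rightarrow> free_alg" where
  "free_v t = (\<Sum>l<2 * p. scale ((\<alpha> * q powi (- (int p - 2 * int t + 1))) ^ l) (gK ^ l))"

lemma q_powi_2p: "(\<alpha> * q powi m) ^ (2 * p) = 1"
proof -
  have "(q powi m) ^ (2 * p) = q powi (m * int (2 * p))"
    by (simp only: power_int_mult power_int_of_nat)
  also have "\<dots> = 1"
    using p2 by (subst qq_powi_eq_1_iff) auto
  finally show ?thesis
    by (simp add: power_mult_distrib power_mult [of \<alpha> 2] power2_eq_square)
qed

text \<open>Multiplication by \<open>gK\<close> shifts the summands cyclically, up to the
  eigenvalue.\<close>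

lemma weight_free_v: "weight (int p - 2 * int t + 1) (free_v t)"
proof -
  define k where "k = int p - 2 * int t + 1"
  define g where "g l = scale ((\<alpha> * q powi (- k)) ^ l) (gK ^ l)" for l
  have free_v: "free_v t = (\<Sum>l<2 * p. g l)"
    by (simp add: free_v_def g_def k_def)
  have step: "gK * g l = scale (\<alpha> * q powi k) (g (Suc l))" for l
    by (simp add: g_def scale_simps power_int_minus field_simps)
  have "gK * free_v t = scale (\<alpha> * q powi k) (\<Sum>l<2 * p. g (Suc l))"
    by (simp add: free_v sum_distrib_left step scale.scale_sum_right)
  also have "(\<Sum>l<2 * p. g (Suc l)) = free_v t + (g (2 * p) - g 0)"
    using sum.lessThan_Suc_shift [of g "2 * p"] unfolding free_v by (simp add: algebra_simps)
  \<comment> \<open>Only the two boundary terms of the shifted sum differ, and both are congruent to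
    1 because \<open>gK ^ (2 * p)\<close> is.\<close>
  also have "scale (\<alpha> * q powi k) \<dots> \<approx> scale (\<alpha> * q powi k) (free_v t + (1 - 1))"
  proof (intro uq_cls_scale_cong uq_cls_add_cong uq_cls_diff_cong refl)
    show "g (2 * p) \<approx> 1"
      using relations(8) by (simp add: g_def q_powi_2p)
  qed (simp add: g_def)
  finally show ?thesis by (simp add: weight_def k_def)
qed

text \<open>Orthogonality of characters of the cyclic group of order 2p, restricted to exponents of
  equal parity.\<close>

lemma geometric_sum_q:
  assumes "i < p" "1 \<le> t" "t \<le> p"
  shows "(\<Sum>l<2 * p. (q powi (2 * (int t - 1 - int i))) ^ l) = (if t = i + 1 then 2 * of_nat p else 0)"
proof (cases "t = i + 1")
  case False
  define z where "z = q powi (2 * (int t - 1 - int i))"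
  have "z \<noteq> 1"
  proof
    assume "z = 1"
    then have "int (2 * p) dvd 2 * (int t - 1 - int i)"
      using p2 by (simp add: z_def qq_powi_eq_1_iff del: of_nat_mult)
    then have "2 * int p dvd 2 * (int t - 1 - int i)"
      by (simp only: of_nat_mult of_nat_numeral)
    then have "int p dvd int t - 1 - int i"
      by (simp only: dvd_mult_cancel_left) simp
    \<comment> \<open>A nonzero integer of absolute value below p is not a multiple of p; both signs
      of the integer are covered.\<close>
    then show False
      using assms False zdvd_imp_le [of "int p" "int t - 1 - int i"]
        zdvd_imp_le [of "int p" "- (int t - 1 - int i)"] dvd_minus_iff [of "int p" "int t - 1 - int i"]
      by linarith
  qed
  moreover have "z ^ (2 * p) = 1"
    using q_powi_2p [of "2 * (int t - 1 - int i)"]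
    by (simp add: z_def power_mult_distrib power_mult [of \<alpha> 2] power2_eq_square)
  ultimately show ?thesis
    using False unfolding z_def [symmetric] by (simp add: geometric_sum)
qed simp

text \<open>Each \<open>gK ^ l\<close> acts on a weight vector by a scalar, so the sum defining
  \<open>free_v\<close> becomes a geometric sum.\<close>

lemma free_v_mult:
  assumes "weight (int p - 1 - 2 * int i) x" "i < p" "1 \<le> t" "t \<le> p"
  shows "free_v t * x \<approx> (if t = i + 1 then scale (2 * of_nat p) x else 0)"
proof -
  define c where "c = \<alpha> * q powi (- (int p - 2 * int t + 1))"
  define z where "z = q powi (2 * (int t - 1 - int i))"
  have "free_v t * x = (\<Sum>l<2 * p. scale (c ^ l) (gK ^ l * x))"
    by (simp add: free_v_def c_def sum_distrib_right scale_simps)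
  also have "\<dots> \<approx> (\<Sum>l<2 * p. scale (c ^ l) (scale ((\<alpha> * q powi (int p - 1 - 2 * int i)) ^ l) x))"
    by (intro uq_cls_sum_cong uq_cls_scale_cong weight_K_power assms)
  also have "c * (\<alpha> * q powi (int p - 1 - 2 * int i)) = z"
    by (simp add: c_def z_def mult_ac flip: power_int_add) (simp add: algebra_simps)
  then have "(\<Sum>l<2 * p. scale (c ^ l) (scale ((\<alpha> * q powi (int p - 1 - 2 * int i)) ^ l) x))
      = scale (\<Sum>l<2 * p. z ^ l) x"
    by (simp add: scale.scale_sum_left scale_simps flip: power_mult_distrib)
  finally show ?thesis
    using geometric_sum_q [OF assms(2-4)] by (simp add: z_def)
qed

section \<open>Highest weight vectors and the idempotents\<close>

text \<open>The scalar by which E takes the i-th vector of an F-string back to the previous one. It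
  vanishes at both ends 0 and p and nowhere between.\<close>

definition EF_coef :: "nat \<Rightarrow> complex" where
  "EF_coef i = \<alpha> * qint p i * qint p (p - i)"

lemma EF_coef_0 [simp]: "EF_coef 0 = 0" and EF_coef_p [simp]: "EF_coef p = 0"
  by (simp_all add: EF_coef_def)

lemma EF_coef_nonzero: "0 < i \<Longrightarrow> i < p \<Longrightarrow> EF_coef i \<noteq> 0"
  by (simp add: EF_coef_def qint_nonzero)

lemma EF_coef_step:
  "i < p \<Longrightarrow> EF_coef i + \<alpha> * (q powi (int p - 1 - 2 * int i) - inverse (q powi (int p - 1 - 2 * int i))) /
     (q - inverse q) = EF_coef (i + 1)"
  using arg_cong [OF qint_product_step [of i p], of "(*) \<alpha>"] p2
  by (simp only: EF_coef_def distrib_left mult.assoc times_divide_eq_right)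

definition highest :: "free_alg \<Rightarrow> bool" where
  "highest w \<longleftrightarrow> gE * w \<approx> 0 \<and> weight (int p - 1) w"

lemma highest_weight_F_power: "highest w \<Longrightarrow> weight (int p - 1 - 2 * int i) (gF ^ i * w)"
  using weight_F_power by (simp add: highest_def)

text \<open>Moving E past one F adds a commutator term, which is exactly the increment of
  \<open>EF_coef\<close>; these increments telescope along the induction.\<close>

lemma highest_E_F:
  assumes w: "highest w"
  shows "i < p \<Longrightarrow> gE * (gF ^ Suc i * w) \<approx> scale (EF_coef (i + 1)) (gF ^ i * w)"
proof (induction i)
  define \<delta> where "\<delta> = 1 / (q - inverse q)"
  have EF: "gE * (gF * x) \<approx> gF * (gE * x) + scale \<delta> (gK * x - gKi * x)" for x
  proof -
    have "gE * (gF * x) = gF * (gE * x) + (gE * gF - gF * gE) * x"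
      by (simp add: algebra_simps)
    also have "\<dots> \<approx> gF * (gE * x) + scale \<delta> (gK - gKi) * x"
      unfolding \<delta>_def by (intro uq_cls_add_cong uq_cls_mult_right relations refl)
    finally show ?thesis by (simp add: scale_simps algebra_simps)
  qed
  have K: "scale \<delta> (gK * (gF ^ i * w) - gKi * (gF ^ i * w))
      \<approx> scale (EF_coef (i + 1) - EF_coef i) (gF ^ i * w)" if "i < p" for i
  proof -
    let ?m = "int p - 1 - 2 * int i" and ?x = "gF ^ i * w"
    have "scale \<delta> (gK * ?x - gKi * ?x)
        \<approx> scale \<delta> (scale (\<alpha> * q powi ?m) ?x - scale (\<alpha> * inverse (q powi ?m)) ?x)"
      using highest_weight_F_power [OF w]
      by (intro uq_cls_scale_cong uq_cls_diff_cong weight_Kinv) (simp_all add: weight_def)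
    also have "\<dots> = uq_cls p (scale (\<alpha> * (q powi ?m - inverse (q powi ?m)) / (q - inverse q)) ?x)"
      by (simp add: \<delta>_def diff_divide_distrib right_diff_distrib scale_simps
          scale.scale_right_diff_distrib scale.scale_left_diff_distrib)
    also have "\<alpha> * (q powi ?m - inverse (q powi ?m)) / (q - inverse q) = EF_coef (i + 1) - EF_coef i"
      using EF_coef_step [OF that] by (simp add: eq_diff_eq add.commute)
    finally show ?thesis .
  qed
  {
    \<comment> \<open>The recursion starts with E killing \<open>w\<close>, in agreement with
      \<open>EF_coef 0 = 0\<close>.\<close>
    case 0
    have "gE * (gF * w) \<approx> gF * (gE * w) + scale \<delta> (gK * w - gKi * w)" by (rule EF)
    also have "\<dots> = uq_cls p (gF * 0 + scale (EF_coef (0 + 1) - EF_coef 0) (gF ^ 0 * w))"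
      using w K [OF 0] by (intro uq_cls_add_cong uq_cls_mult_left) (simp_all add: highest_def)
    finally show ?case by simp
  next
    case (Suc i)
    let ?x = "gF ^ Suc i * w"
    have "gE * (gF ^ Suc (Suc i) * w) = gE * (gF * ?x)" by (simp add: mult.assoc)
    also have "\<dots> \<approx> gF * (gE * ?x) + scale \<delta> (gK * ?x - gKi * ?x)" by (rule EF)
    also have "\<dots> = uq_cls p (gF * scale (EF_coef (i + 1)) (gF ^ i * w)
        + scale (EF_coef (Suc i + 1) - EF_coef (Suc i)) ?x)"
      using Suc by (intro uq_cls_add_cong uq_cls_mult_left K) auto
    also have "gF * scale (EF_coef (i + 1)) (gF ^ i * w) = scale (EF_coef (Suc i)) ?x"
      by (simp add: scale_simps mult.assoc)
    finally show ?case by (simp flip: scale.scale_left_distrib)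
  }
qed

text \<open>For \<open>n = p - 1\<close> the scalar is the product in the normalisation of
  \<open>e_elt\<close>.\<close>

lemma highest_E_power_F_power:
  assumes w: "highest w"
  shows "n < p \<Longrightarrow> gE ^ n * (gF ^ n * w) \<approx> scale (\<Prod>i=1..n. EF_coef i) w"
proof (induction n)
  case (Suc n)
  have "gE ^ Suc n * (gF ^ Suc n * w) = gE ^ n * (gE * (gF ^ Suc n * w))"
    by (simp add: power_commutes mult.assoc [symmetric])
  also have "\<dots> \<approx> gE ^ n * scale (EF_coef (n + 1)) (gF ^ n * w)"
    using Suc.prems by (intro uq_cls_mult_left highest_E_F w) simp
  also have "\<dots> = uq_cls p (scale (EF_coef (n + 1)) (gE ^ n * (gF ^ n * w)))"
    by (simp add: scale_simps)
  also have "\<dots> = uq_cls p (scale (EF_coef (n + 1)) (scale (\<Prod>i=1..n. EF_coef i) w))"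
    using Suc by (intro uq_cls_scale_cong) simp
  finally show ?case by (simp add: mult.commute)
qed simp

definition free_w :: "nat \<Rightarrow> free_alg" where
  "free_w t = gE ^ (p - 1) * (gF ^ (p - t) * free_v t)"

text \<open>One more E completes the power \<open>gE ^ p\<close>, which vanishes; the weight is the
  sum of the shifts along the factors.\<close>

lemma highest_free_w: "1 \<le> t \<Longrightarrow> t \<le> p \<Longrightarrow> highest (free_w t)"
  unfolding highest_def
proof
  have "gE * free_w t = gE ^ p * (gF ^ (p - t) * free_v t)"
    using p2 by (simp add: free_w_def mult.assoc [symmetric] flip: power_Suc)
  also have "\<dots> \<approx> 0 * (gF ^ (p - t) * free_v t)"
    by (intro uq_cls_mult_right relations)
  finally show "gE * free_w t \<approx> 0" by simp
  assume t: "1 \<le> t" "t \<le> p"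
  then have "int p - 2 * int t + 1 - 2 * int (p - t) + 2 * int (p - 1) = int p - 1"
    by simp
  then show "weight (int p - 1) (free_w t)"
    using weight_E_power [OF weight_F_power [OF weight_free_v [of t], of "p - t"], of "p - 1"]
    by (simp only: free_w_def)
qed

definition norm_const :: complex where
  "norm_const = 1 / (2 * of_nat p * (\<Prod>i=1..p - 1. EF_coef i))"

definition free_e :: "nat \<Rightarrow> free_alg" where
  "free_e t = scale norm_const (gF ^ (t - 1) * free_w t)"

lemma e_elt_eq: "e_elt p \<alpha> t = uq_cls p (free_e t)"
proof -
  have "v_elt p \<alpha> p t = uq_cls p (free_v t)"
    unfolding v_elt_def free_v_def uK_def by (simp only: uq_cls_simps)
  then show ?thesis
    by (simp add: e_elt_def a_elt_def uE_def uF_def uq_cls_simps free_e_def free_w_def norm_const_def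
        EF_coef_def mult.assoc)
qed

text \<open>\<open>free_v t\<close> selects the vector with \<open>i = t - 1\<close>. It is pushed
  down to the end of the string, raised to the top \<open>w\<close>, and lowered back, which costs
  the scalar inverse to \<open>norm_const\<close>. The vector \<open>w\<close> is arbitrary, so that
  products with different \<open>t\<close> are covered.\<close>

lemma free_e_mult:
  assumes w: "highest w" and t: "1 \<le> t" "t \<le> p" and i: "i < p"
  shows "free_e t * (gF ^ i * w) \<approx> (if t = i + 1 then gF ^ i * w else 0)"
proof -
  let ?A = "gF ^ (t - 1) * (gE ^ (p - 1) * gF ^ (p - t))"
  have "free_e t * (gF ^ i * w) = scale norm_const (?A * (free_v t * (gF ^ i * w)))"
    by (simp add: free_e_def free_w_def scale_simps mult.assoc)
  also have "\<dots> \<approx> scale norm_const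
      (?A * (if t = i + 1 then scale (2 * of_nat p) (gF ^ i * w) else 0))"
    using t i w by (intro uq_cls_scale_cong uq_cls_mult_left free_v_mult highest_weight_F_power)
  also have "\<dots> = uq_cls p (if t = i + 1 then gF ^ i * w else 0)"
  proof (cases "t = i + 1")
    case True
    let ?P = "\<Prod>i=1..p - 1. EF_coef i"
    have "?P \<noteq> 0" using p2 EF_coef_nonzero by auto
    have "gF ^ (p - t) * gF ^ i = gF ^ (p - 1)"
      using True i by (simp flip: power_add)
    then have "?A * (gF ^ i * w) = gF ^ i * (gE ^ (p - 1) * (gF ^ (p - 1) * w))"
      by (simp add: True mult.assoc [symmetric]) (simp add: mult.assoc)
    also have "\<dots> \<approx> gF ^ i * scale ?P w"
      using p2 by (intro uq_cls_mult_left highest_E_power_F_power w) simp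
    finally have "?A * (gF ^ i * w) \<approx> scale ?P (gF ^ i * w)"
      by (simp add: scale_simps)
    then have "scale (norm_const * (2 * of_nat p)) (?A * (gF ^ i * w))
        \<approx> scale (norm_const * (2 * of_nat p)) (scale ?P (gF ^ i * w))"
      by (rule uq_cls_scale_cong)
    moreover have "norm_const * (2 * of_nat p) * ?P = 1"
      using p2 \<open>?P \<noteq> 0\<close> by (simp add: norm_const_def)
    ultimately show ?thesis
      using True by (simp add: scale_simps)
  qed simp
  finally show ?thesis .
qed

lemma free_e_mult_free_e:
  assumes "1 \<le> t1" "t1 \<le> p" "1 \<le> t2" "t2 \<le> p"
  shows "free_e t1 * free_e t2 \<approx> (if t1 = t2 then free_e t2 else 0)"
proof -
  have "free_e t1 * free_e t2 = scale norm_const (free_e t1 * (gF ^ (t2 - 1) * free_w t2))"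
    by (simp add: free_e_def [of t2] scale_simps)
  \<comment> \<open>The second factor is itself a string vector, with index
    \<open>i = t2 - 1\<close>.\<close>
  also have "\<dots> \<approx> scale norm_const (if t1 = (t2 - 1) + 1 then gF ^ (t2 - 1) * free_w t2 else 0)"
    using assms by (intro uq_cls_scale_cong free_e_mult highest_free_w) auto
  also have "\<dots> = uq_cls p (if t1 = t2 then free_e t2 else 0)"
    using assms by (auto simp: free_e_def)
  finally show ?thesis .
qed

text \<open>Linear combinations of the F-string of \<open>w\<close>, closed under congruence; the
  inductive form avoids families of coefficients.\<close>

inductive_set span_F :: "free_alg \<Rightarrow> free_alg set" for w where
  zero: "x \<approx> 0 \<Longrightarrow> x \<in> span_F w"
| add: "x \<in> span_F w \<Longrightarrow> i < p \<Longrightarrow> y \<approx> scale c (gF ^ i * w) + x \<Longrightarrow> y \<in> span_F w"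

lemma span_F_cong: "x \<in> span_F w \<Longrightarrow> y \<approx> x \<Longrightarrow> y \<in> span_F w"
  by (erule span_F.cases) (auto intro: span_F.intros)

lemma span_F_base: "i < p \<Longrightarrow> scale c (gF ^ i * w) \<in> span_F w"
  by (rule span_F.add [OF span_F.zero [of 0 w]]) auto

lemma span_F_add: "x \<in> span_F w \<Longrightarrow> y \<in> span_F w \<Longrightarrow> x + y \<in> span_F w"
proof (induction rule: span_F.induct)
  case (zero x)
  then show ?case
    using uq_cls_add_cong [of p x 0 y y] by (auto intro: span_F_cong)
next
  case (add x i x' c)
  then show ?case
    using uq_cls_add_cong [of p x' "scale c (gF ^ i * w) + x" y y]
    by (auto intro!: span_F.add [of "x + y" w i _ c] simp: add.assoc)
qed

lemma span_F_scale: "x \<in> span_F w \<Longrightarrow> scale c x \<in> span_F w"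
proof (induction rule: span_F.induct)
  case (zero x)
  then show ?case using uq_cls_scale_cong [of p x 0 c] by (auto intro: span_F.zero)
next
  case (add x i y d)
  then show ?case
    using uq_cls_scale_cong [of p y "scale d (gF ^ i * w) + x" c]
    by (auto intro!: span_F.add [of "scale c x" w i _ "c * d"] simp: scale.scale_right_distrib scale_simps)
qed

lemma span_F_mult:
  assumes "\<And>i. i < p \<Longrightarrow> g * (gF ^ i * w) \<in> span_F w" and "x \<in> span_F w"
  shows "g * x \<in> span_F w"
  using assms(2)
proof (induction rule: span_F.induct)
  case (zero x)
  then show ?case using uq_cls_mult_left [of p x 0 g] by (auto intro: span_F.zero)
next
  case (add x i y d)
  have "scale d (g * (gF ^ i * w)) + g * x \<in> span_F w"
    using add assms(1) by (intro span_F_add span_F_scale)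
  then show ?case
    using uq_cls_mult_left [OF add.hyps(3), of g]
    by (auto intro: span_F_cong simp: distrib_left scale_simps)
qed

text \<open>E lowers the index of a string vector by \<open>highest_E_F\<close>, F raises it until
  \<open>gF ^ p\<close> vanishes, and K with its inverse act diagonally.\<close>

lemma span_F_gen:
  assumes w: "highest w" and x: "x \<in> span_F w"
  shows "free_gen g * x \<in> span_F w"
proof (rule span_F_mult [OF _ x])
  fix i assume i: "i < p"
  show "free_gen g * (gF ^ i * w) \<in> span_F w"
  proof (cases g)
    case Gen_E
    show ?thesis
    proof (cases i)
      case 0
      then show ?thesis using w Gen_E by (simp add: highest_def span_F.zero)
    next
      case (Suc j)
      then show ?thesis
        using highest_E_F [OF w, of j] i Gen_E
        by (auto intro!: span_F_cong [OF span_F_base [of j "EF_coef (Suc j)"]])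
    qed
  next
    case Gen_F
    have F: "gF * (gF ^ i * w) = gF ^ Suc i * w" by (simp add: mult.assoc)
    show ?thesis
    proof (cases "Suc i = p")
      case True
      then have "gF * (gF ^ i * w) \<approx> 0"
        using uq_cls_mult_right [OF relations(7), of w] F by simp
      then show ?thesis using Gen_F by (simp add: span_F.zero)
    next
      case False
      then show ?thesis
        using span_F_base [of "Suc i" 1 w] i F Gen_F by simp
    qed
  next
    case Gen_K
    then show ?thesis
      using highest_weight_F_power [OF w, of i] i by (auto simp: weight_def intro: span_F_cong span_F_base)
  next
    case Gen_Kinv
    then show ?thesis
      using weight_Kinv [OF highest_weight_F_power [OF w, of i]] i
      by (auto intro: span_F_cong span_F_base)
  qed
qed

lemma span_F_left_ideal:
  assumes w: "highest w" and x: "x \<in> span_F w"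
  shows "y * x \<in> span_F w"
proof (induction y rule: free_alg_induct)
  case zero
  then show ?case by (simp add: span_F.zero)
next
  case (add u c y)
  have "Poly_Mapping.single (Word u) c * x \<in> span_F w"
    by (induction u)
      (auto simp: single_Word_Nil single_Word_Cons scale_simps mult.assoc intro: span_F_scale span_F_gen x w)
  with add show ?case by (simp add: distrib_right span_F_add)
qed

text \<open>\<open>free_e t\<close> reads off the coefficient of the string vector with index
  \<open>t - 1\<close>, which is proportional to \<open>free_e t\<close> itself.\<close>

lemma free_e_span:
  assumes "x \<in> span_F (free_w t)" "1 \<le> t" "t \<le> p"
  shows "\<exists>c. free_e t * x \<approx> scale c (free_e t)"
  using assms(1)
proof (induction rule: span_F.induct)
  case (zero x)
  then show ?case using uq_cls_mult_left [of p x 0 "free_e t"] by (intro exI [of _ 0]) simp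
next
  case (add x i y d)
  then obtain c where c: "free_e t * x \<approx> scale c (free_e t)" by blast
  have "norm_const \<noteq> 0"
    using p2 EF_coef_nonzero by (auto simp: norm_const_def)
  have "free_e t * y \<approx> free_e t * (scale d (gF ^ i * free_w t) + x)"
    by (rule uq_cls_mult_left) fact
  also have "\<dots> = uq_cls p (scale d (free_e t * (gF ^ i * free_w t)) + free_e t * x)"
    by (simp add: distrib_left scale_simps)
  also have "\<dots> = uq_cls p (scale d (if t = i + 1 then gF ^ i * free_w t else 0) + scale c (free_e t))"
    using assms add.hyps by (intro uq_cls_add_cong uq_cls_scale_cong free_e_mult c highest_free_w)
  \<comment> \<open>Division by \<open>norm_const\<close> rewrites the string vector as a multiple
    of \<open>free_e t\<close>.\<close>
  also have "\<dots> = uq_cls p (scale ((if t = i + 1 then d / norm_const else 0) + c) (free_e t))"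
    using \<open>norm_const \<noteq> 0\<close> by (simp add: free_e_def scale.scale_left_distrib scale_simps distrib_right)
  finally show ?case by blast
qed

lemma free_e_corner:
  assumes "1 \<le> t" "t \<le> p"
  shows "\<exists>c. free_e t * x * free_e t \<approx> scale c (free_e t)"
proof -
  have "free_e t \<in> span_F (free_w t)"
    unfolding free_e_def using assms by (intro span_F_base) simp
  then have "x * free_e t \<in> span_F (free_w t)"
    using assms by (intro span_F_left_ideal highest_free_w)
  from free_e_span [OF this assms] show ?thesis by (simp add: mult.assoc)
qed

text \<open>On the string vector proportional to \<open>free_e t\<close>, the summand EF acts by
  \<open>EF_coef t\<close> and the rest by the weight; \<open>qint_product_casimir\<close> adds the
  two.\<close>

lemma casimir_free_e:
  assumes "1 \<le> t" "t \<le> p"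
  shows "(gE * gF + scale (1 / (q - inverse q) ^ 2) (scale (inverse q) gK + scale q gKi)) * free_e t
    \<approx> scale (- 2 * \<alpha> / (q - inverse q) ^ 2) (free_e t)"
proof -
  define i where "i = t - 1"
  define x where "x = gF ^ i * free_w t"
  define m where "m = int p - 1 - 2 * int i"
  define d where "d = (q - inverse q) ^ 2"
  have free_e: "free_e t = scale norm_const x"
    by (simp add: free_e_def x_def i_def)
  have i: "i < p" using assms by (simp add: i_def)
  have w: "highest (free_w t)" using assms by (rule highest_free_w)
  have m: "weight m x" unfolding m_def x_def by (rule highest_weight_F_power [OF w])
  have "gE * (gF * x) = gE * (gF ^ Suc i * free_w t)" by (simp add: x_def mult.assoc)
  also have "\<dots> \<approx> scale (EF_coef (i + 1)) x"
    unfolding x_def by (rule highest_E_F [OF w i])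
  finally have EF: "gE * (gF * x) \<approx> scale (EF_coef (i + 1)) x" .
  have "(gE * gF + scale (1 / d) (scale (inverse q) gK + scale q gKi)) * x
    = gE * (gF * x) + scale (1 / d) (scale (inverse q) (gK * x) + scale q (gKi * x))"
    by (simp add: algebra_simps scale_simps scale.scale_right_distrib)
  also have "\<dots> \<approx> scale (EF_coef (i + 1)) x + scale (1 / d) (scale (inverse q) (scale (\<alpha> * q powi m) x) +
      scale q (scale (\<alpha> * inverse (q powi m)) x))"
    using m EF by (intro uq_cls_add_cong uq_cls_scale_cong weight_Kinv) (auto simp: weight_def)
  also have "\<dots> = uq_cls p (scale (EF_coef (i + 1) + \<alpha> * ((inverse q * q powi m + q * inverse (q powi m)) / d)) x)"
    by (simp add: scale_simps mult_ac distrib_left add_divide_distrib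
        scale.scale_left_distrib scale.scale_right_distrib)
  also have "EF_coef (i + 1) + \<alpha> * ((inverse q * q powi m + q * inverse (q powi m)) / d) = - 2 * \<alpha> / d"
    using arg_cong [OF qint_product_casimir [OF i], of "(*) \<alpha>"]
    by (simp add: EF_coef_def m_def d_def distrib_left mult_ac)
  finally have "scale norm_const ((gE * gF + scale (1 / d) (scale (inverse q) gK + scale q gKi)) * x)
      \<approx> scale norm_const (scale (- 2 * \<alpha> / d) x)"
    by (rule uq_cls_scale_cong)
  then show ?thesis
    unfolding free_e d_def [symmetric] by (simp add: scale_mult_right mult_ac)
qed

section \<open>The simple module of dimension p\<close>

text \<open>The simple module lives on the coordinates \<open>{..<p}\<close> of \<open>nat \<Rightarrow> complex\<close>. Letting \<open>E\<close> and
  \<open>F\<close> vanish and \<open>K\<close> be the identity on the other coordinates makes all relations hold without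
  a support condition.\<close>

definition K_value :: "nat \<Rightarrow> complex" where
  "K_value n = (if n < p then \<alpha> * q powi (int p - 1 - 2 * int n) else 1)"

text \<open>The value \<open>f n\<close> is the coefficient of the n-th vector of the F-string, so
  these are the formulas found above for highest weight vectors.\<close>

fun gen_act :: "gen \<Rightarrow> (nat \<Rightarrow> complex) \<Rightarrow> nat \<Rightarrow> complex" where
  "gen_act Gen_E f n = (if n + 1 < p then EF_coef (n + 1) * f (n + 1) else 0)"
| "gen_act Gen_F f n = (if 0 < n \<and> n < p then f (n - 1) else 0)"
| "gen_act Gen_K f n = K_value n * f n"
| "gen_act Gen_Kinv f n = inverse (K_value n) * f n"

fun word_act :: "gen_word \<Rightarrow> (nat \<Rightarrow> complex) \<Rightarrow> nat \<Rightarrow> complex" where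
  "word_act (Word u) = foldr gen_act u"

definition act :: "free_alg \<Rightarrow> (nat \<Rightarrow> complex) \<Rightarrow> nat \<Rightarrow> complex" where
  "act x f n = (\<Sum>u\<in>Poly_Mapping.keys x. Poly_Mapping.lookup x u * word_act u f n)"

section \<open>The action as a representation of the free algebra\<close>

lemma act_superset:
  "finite A \<Longrightarrow> Poly_Mapping.keys x \<subseteq> A \<Longrightarrow>
    act x f n = (\<Sum>u\<in>A. Poly_Mapping.lookup x u * word_act u f n)"
  unfolding act_def by (rule sum.mono_neutral_left) (auto simp: in_keys_iff)

lemma act_add: "act (x + y) f n = act x f n + act y f n"
proof -
  let ?A = "Poly_Mapping.keys x \<union> Poly_Mapping.keys y"
  have "finite ?A" by simp
  moreover have "Poly_Mapping.keys (x + y) \<subseteq> ?A" by (rule Poly_Mapping.keys_add)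
  ultimately show ?thesis
    by (simp add: act_superset [of ?A] lookup_add distrib_right sum.distrib)
qed

lemma act_zero [simp]: "act 0 f n = 0"
  by (simp add: act_def)

lemma act_single: "act (Poly_Mapping.single w c) f n = c * word_act w f n"
  by (simp add: act_superset [of "{w}"])

lemma act_uminus: "act (- x) f n = - act x f n"
  using act_add [of x "- x" f n] by (simp add: eq_neg_iff_add_eq_0 add.commute)

lemma act_diff: "act (x - y) f n = act x f n - act y f n"
  using act_add [of x "- y" f n] by (simp add: act_uminus)

lemma act_sum: "act (\<Sum>i\<in>A. g i) f n = (\<Sum>i\<in>A. act (g i) f n)"
  by (induction A rule: infinite_finite_induct) (simp_all add: act_add)

lemma act_scale: "act (scale c x) f n = c * act x f n"
proof (induction x rule: free_alg_induct)
  case (add u d x)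
  have "scale c (Poly_Mapping.single (Word u) d) = Poly_Mapping.single (Word u) (c * d)"
    by (simp add: scale_def free_const_def mult_single)
  then show ?case
    using add by (simp add: scale.scale_right_distrib act_add act_single distrib_left)
qed simp

lemma gen_act_linear: "gen_act g (\<lambda>n. c * f n + h n) = (\<lambda>n. c * gen_act g f n + gen_act g h n)"
  by (cases g) (auto simp: fun_eq_iff algebra_simps)

lemma act_gen_mult: "act (free_gen g * x) f = gen_act g (act x f)"
proof (induction x rule: free_alg_induct)
  case zero
  have "gen_act g (\<lambda>_. 0) = (\<lambda>_. 0)" by (cases g) (auto simp: fun_eq_iff)
  moreover have "act 0 f = (\<lambda>_. 0)" by (simp add: fun_eq_iff)
  ultimately show ?case by simp
next
  case (add u c x)
  have "act (free_gen g * (Poly_Mapping.single (Word u) c + x)) f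
      = (\<lambda>n. c * gen_act g (word_act (Word u) f) n + gen_act g (act x f) n)"
    by (simp add: fun_eq_iff distrib_left act_add add act_single flip: single_Word_Cons)
  also have "\<dots> = gen_act g (\<lambda>n. c * word_act (Word u) f n + act x f n)"
    by (rule gen_act_linear [symmetric])
  also have "(\<lambda>n. c * word_act (Word u) f n + act x f n) = act (Poly_Mapping.single (Word u) c + x) f"
    by (simp add: fun_eq_iff act_add act_single)
  finally show ?case .
qed

lemma act_mult: "act (x * y) f = act x (act y f)"
proof (induction x rule: free_alg_induct)
  case zero
  then show ?case by (simp add: fun_eq_iff)
next
  case (add u c x)
  have "act (Poly_Mapping.single (Word u) c * y) f = (\<lambda>n. c * word_act (Word u) (act y f) n)"
  proof (induction u)
    case Nil
    then show ?case by (simp add: fun_eq_iff single_Word_Nil scale_simps act_scale)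
  next
    case (Cons g u)
    \<comment> \<open>The summand 0 brings the function into the shape of
      \<open>gen_act_linear\<close>.\<close>
    then have "act (Poly_Mapping.single (Word (g # u)) c * y) f
        = gen_act g (\<lambda>n. c * word_act (Word u) (act y f) n + 0)"
      by (simp add: single_Word_Cons mult.assoc act_gen_mult)
    also have "\<dots> = (\<lambda>n. c * gen_act g (word_act (Word u) (act y f)) n + gen_act g (\<lambda>_. 0) n)"
      by (rule gen_act_linear)
    also have "gen_act g (\<lambda>_. 0) = (\<lambda>_. 0)" by (cases g) (auto simp: fun_eq_iff)
    finally show ?case by simp
  qed
  then show ?case
    using add by (simp add: fun_eq_iff distrib_right act_add act_single)
qed

lemma act_one [simp]: "act 1 f = f"
  using act_single [of "Word []" 1 f] by (simp add: fun_eq_iff single_Word_Nil)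

lemma act_gen: "act (free_gen g) f = gen_act g f"
  using act_gen_mult [of g 1 f] by simp

lemma act_zero_right: "act x (\<lambda>_. 0) = (\<lambda>_. 0)"
  using act_mult [of x 0 undefined] act_zero [abs_def] by simp

text \<open>Reduces the descent of the action to checking the relators, by minimality of the
  generated ideal.\<close>

lemma ideal_act_kernel: "ideal {x. \<forall>f n. act x f n = 0} free_ring"
proof (rule idealI [OF ring_free_ring])
  show "subgroup {x. \<forall>f n. act x f n = 0} (add_monoid free_ring)"
  proof (rule subgroup.intro)
    fix x assume "x \<in> {x. \<forall>f n. act x f n = 0}"
    moreover have "inv\<^bsub>add_monoid free_ring\<^esub> x = - x"
      using free_ring_a_inv by (simp only: a_inv_def)
    ultimately show "inv\<^bsub>add_monoid free_ring\<^esub> x \<in> {x. \<forall>f n. act x f n = 0}"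
      by (simp only: mem_Collect_eq act_uminus) simp
  qed (auto simp: act_add)
next
  fix a x assume "a \<in> {x. \<forall>f n. act x f n = 0}"
  then have a: "act a f = (\<lambda>_. 0)" for f by (auto simp: fun_eq_iff)
  then show "x \<otimes>\<^bsub>free_ring\<^esub> a \<in> {x. \<forall>f n. act x f n = 0}"
    and "a \<otimes>\<^bsub>free_ring\<^esub> x \<in> {x. \<forall>f n. act x f n = 0}"
    by (simp_all add: act_mult act_zero_right)
qed

text \<open>Coordinate n of the result could only depend on coordinate \<open>n + Suc m\<close>,
  which lies outside the module.\<close>

lemma act_E_power_eq_0: "n + Suc m \<ge> p \<Longrightarrow> act (gE ^ Suc m) f n = 0"
  by (induction m arbitrary: n) (simp_all add: act_gen act_gen_mult)

lemma act_F_power_eq_0: "n < Suc m \<or> n \<ge> p \<Longrightarrow> act (gF ^ Suc m) f n = 0"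
proof (induction m arbitrary: n)
  case (Suc m)
  have "act (gF ^ Suc (Suc m)) f n = gen_act Gen_F (act (gF ^ Suc m) f) n"
    by (subst power_Suc) (simp only: act_gen_mult)
  then show ?case
    using Suc.IH [of "n - 1"] Suc.prems by (cases n) (auto simp del: power_Suc)
qed (auto simp: act_gen)

lemma act_K_power: "act (gK ^ m) f n = K_value n ^ m * f n"
  by (induction m) (simp_all add: act_gen_mult)

lemma K_value_nonzero [simp]: "K_value n \<noteq> 0"
  by (simp add: K_value_def)

lemma K_value_Suc: "Suc n < p \<Longrightarrow> K_value n = q ^ 2 * K_value (Suc n)"
proof -
  assume n: "Suc n < p"
  have "q powi (int p - 1 - 2 * int n) = q powi (2 + (int p - 1 - 2 * int (Suc n)))"
    by (rule arg_cong [of _ _ "(powi) q"]) simp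
  also have "\<dots> = q ^ 2 * q powi (int p - 1 - 2 * int (Suc n))"
    by (subst power_int_add) auto
  finally show ?thesis using n by (simp only: K_value_def mult_ac if_True Suc_lessD)
qed

lemma act_relator:
  assumes "x \<in> uq_relators p"
  shows "act x f n = 0"
proof -
  note act_simps = act_diff act_add act_mult act_gen act_K_power act_scale
  have "act (gE * gF - gF * gE - scale (1 / (q - inverse q)) (gK - gKi)) f n = 0"
  proof (cases "n < p")
    case True
    have "EF_coef n + (K_value n - inverse (K_value n)) / (q - inverse q) = EF_coef (n + 1)"
      using EF_coef_step [OF True] True by (simp add: K_value_def right_diff_distrib)
    then have "EF_coef (n + 1) * f n - EF_coef n * f n - (K_value n - inverse (K_value n)) / (q - inverse q) * f n = 0"
      by (metis add_diff_cancel_left' diff_self distrib_right)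
    \<comment> \<open>At the ends \<open>n + 1 = p\<close> here and \<open>n = 0\<close> in the next
      claim the action is cut off, in agreement with the zeros of \<open>EF_coef\<close>.\<close>
    moreover have "act (gE * gF) f n = EF_coef (n + 1) * f n"
      using True by (cases "n + 1 = p") (auto simp: act_simps)
    moreover have "act (gF * gE) f n = EF_coef n * f n"
      using True by (cases n) (auto simp: act_simps)
    ultimately show ?thesis
      by (simp add: act_diff act_scale act_gen left_diff_distrib)
  next
    case False
    \<comment> \<open>Outside the module E and F vanish, and K agrees with its inverse
      there.\<close>
    then show ?thesis by (simp add: act_simps K_value_def)
  qed
  moreover have "act (gK * gE * gKi - scale (q ^ 2) gE) f n = 0"
    using K_value_Suc [of n] by (auto simp: act_simps)
  moreover have "act (gK * gF * gKi - scale (inverse (q ^ 2)) gF) f n = 0"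
    using K_value_Suc [of "n - 1"] by (auto simp: act_simps)
  moreover have "act (gE ^ p) f n = 0" "act (gF ^ p) f n = 0"
    using act_E_power_eq_0 [of n "p - 1" f] act_F_power_eq_0 [of n "p - 1" f] p2
    by (auto simp flip: not_less)
  moreover have "act (gK ^ (2 * p) - 1) f n = 0"
    by (simp add: act_diff act_K_power K_value_def q_powi_2p)
  moreover have "act (gK * gKi - 1) f n = 0" "act (gKi * gK - 1) f n = 0"
    by (simp_all add: act_simps)
  ultimately show ?thesis
    using assms by (auto simp: uq_relators_def Let_def simp flip: scale_def)
qed

lemma act_cong: "x \<approx> y \<Longrightarrow> act x f n = act y f n"
proof -
  assume "x \<approx> y"
  then have "x - y \<in> Idl\<^bsub>free_ring\<^esub> (uq_relators p)" by (simp only: uq_cls_eq_iff)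
  also have "\<dots> \<subseteq> {x. \<forall>f n. act x f n = 0}"
    using act_relator by (intro ring.genideal_minimal ring_free_ring ideal_act_kernel) auto
  finally show ?thesis by (simp add: act_diff)
qed

section \<open>Evaluating \<open>free_e\<close> on the module\<close>

lemma act_E_power: "n + m < p \<Longrightarrow> act (gE ^ m) f n = (\<Prod>j=1..m. EF_coef (n + j)) * f (n + m)"
proof (induction m arbitrary: f)
  case (Suc m)
  have "act (gE ^ Suc m) f n = act (gE ^ m) (gen_act Gen_E f) n"
    by (simp add: power_Suc2 act_mult act_gen del: power_Suc)
  with Suc show ?case by (simp add: mult_ac)
qed simp

lemma act_F_power: "n + m < p \<Longrightarrow> act (gF ^ m) f (n + m) = f n"
  by (induction m) (simp_all add: act_gen_mult)

text \<open>At coordinate \<open>t - 1\<close> the eigenvalue of K cancels the coefficient, so all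
  2p summands agree.\<close>

lemma act_free_v:
  assumes "1 \<le> t" "t \<le> p"
  shows "act (free_v t) f (t - 1) = 2 * of_nat p * f (t - 1)"
proof -
  define k where "k = int p - 2 * int t + 1"
  have "t - 1 < p" "int p - 1 - 2 * int (t - 1) = k"
    using assms by (simp_all add: k_def)
  then have "K_value (t - 1) = \<alpha> * q powi k"
    by (simp only: K_value_def if_True)
  then have "(\<alpha> * q powi (- k)) * K_value (t - 1) = 1"
    by (simp add: power_int_minus field_simps)
  moreover have "act (free_v t) f (t - 1) = (\<Sum>l<2 * p. ((\<alpha> * q powi (- k)) * K_value (t - 1)) ^ l * f (t - 1))"
    unfolding power_mult_distrib [of "\<alpha> * q powi (- k)"]
    by (simp add: free_v_def k_def act_sum act_scale act_K_power mult.assoc)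
  ultimately show ?thesis by simp
qed

lemma norm_const_prod: "norm_const * ((\<Prod>i=1..p - 1. EF_coef i) * (2 * of_nat p)) = 1"
  using p2 EF_coef_nonzero by (auto simp: norm_const_def)

lemma free_e_nonzero:
  assumes t: "1 \<le> t" "t \<le> p"
  shows "\<not> free_e t \<approx> 0"
proof
  assume "free_e t \<approx> 0"
  \<comment> \<open>The computation evaluates this vector only at coordinate \<open>t - 1\<close>,
    where it has to be nonzero.\<close>
  let ?f = "\<lambda>_. 1 :: complex"
  have "act (free_e t) ?f (t - 1)
      = norm_const * act (gF ^ (t - 1)) (act (gE ^ (p - 1)) (act (gF ^ (p - t)) (act (free_v t) ?f))) (0 + (t - 1))"
    by (simp add: free_e_def free_w_def act_scale act_mult)
  \<comment> \<open>The evaluation passes from coordinate \<open>t - 1\<close> to 0, then to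
    \<open>p - 1\<close>, and in the next step back to \<open>t - 1\<close>.\<close>
  also have "\<dots> = norm_const * ((\<Prod>i=1..p - 1. EF_coef i) * act (gF ^ (p - t)) (act (free_v t) ?f) ((t - 1) + (p - t)))"
    using t p2 by (subst act_F_power) (auto simp: act_E_power)
  also have "\<dots> = norm_const * ((\<Prod>i=1..p - 1. EF_coef i) * (2 * of_nat p))"
    using t by (subst act_F_power) (simp_all only: act_free_v [OF t], simp)
  finally have "act (free_e t) ?f (t - 1) = 1" by (simp only: norm_const_prod)
  with act_cong [OF \<open>free_e t \<approx> 0\<close>, of ?f "t - 1"] show False by simp
qed

section \<open>Primitivity\<close>

text \<open>The eigenvalue numerator is -2 for \<open>s = p\<close> and 2 for \<open>s = 0\<close>,
  which is \<open>- 2 * \<alpha>\<close> in both cases.\<close>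

lemma free_e_in_Q_space:
  assumes t: "1 \<le> t" "t \<le> p" and s: "s = (if \<alpha> = 1 then p else 0)"
  shows "uq_cls p (free_e t) \<in> Q_space p s"
proof -
  define C where "C = gE * gF + scale (1 / (q - inverse q) ^ 2) (scale (inverse q) gK + scale q gKi)"
  define c where "c = - 2 * \<alpha> / (q - inverse q) ^ 2"
  have C: "casimir p = uq_cls p C"
    by (simp only: casimir_def C_def uE_def uF_def uK_def uKinv_def uq_cls_simps)
  have "casimir_eigenvalue p s = c"
    using sign p2 s by (auto simp: casimir_eigenvalue_def c_def power_int_minus qq_power_p)
  moreover have "C * free_e t - scale c (free_e t) \<approx> scale c (free_e t) - scale c (free_e t)"
    unfolding C_def c_def by (intro uq_cls_diff_cong casimir_free_e t refl)
  \<comment> \<open>A genuine eigenvector lies in the generalized eigenspace with exponent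
    1.\<close>
  then have "(C - scale c 1) ^ 1 * free_e t \<approx> 0"
    by (simp add: left_diff_distrib scale_simps)
  ultimately have "((casimir p \<ominus>\<^bsub>Uq p\<^esub> uq_scale p (casimir_eigenvalue p s) \<one>\<^bsub>Uq p\<^esub>)
      [^]\<^bsub>Uq p\<^esub> (1::nat)) \<otimes>\<^bsub>Uq p\<^esub> uq_cls p (free_e t) = \<zero>\<^bsub>Uq p\<^esub>"
    by (simp only: C uq_cls_one uq_cls_zero uq_cls_simps)
  then show ?thesis
    unfolding Q_space_def by (blast intro: carrier_Uq [THEN equalityD2, THEN subsetD])
qed

text \<open>In an orthogonal splitting e = f + g one has f = efe. The corner is spanned by e, so f =
  ce with c^2 = c, and f is 0 or e.\<close>

lemma primitive_idempotent_free_e: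
  assumes t: "1 \<le> t" "t \<le> p" and s: "s = (if \<alpha> = 1 then p else 0)"
  shows "primitive_idempotent (Q p s) (e_elt p \<alpha> t)"
proof -
  let ?e = "uq_cls p (free_e t)"
  have idem: "uq_cls p (free_e t * free_e t) = ?e"
    using free_e_mult_free_e [OF t t] by simp
  have "f = \<zero>\<^bsub>Uq p\<^esub> \<or> g = \<zero>\<^bsub>Uq p\<^esub>"
    if f: "f \<in> Q_space p s" "f \<otimes>\<^bsub>Uq p\<^esub> f = f" and g: "g \<in> Q_space p s"
      and fg: "f \<otimes>\<^bsub>Uq p\<^esub> g = \<zero>\<^bsub>Uq p\<^esub>" "g \<otimes>\<^bsub>Uq p\<^esub> f = \<zero>\<^bsub>Uq p\<^esub>"
      and e: "?e = f \<oplus>\<^bsub>Uq p\<^esub> g" for f g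
  proof -
    obtain x y where x: "f = uq_cls p x" and y: "g = uq_cls p y"
      using f g by (auto simp: Q_space_def carrier_Uq)
    have e: "free_e t \<approx> x + y" and xx: "x * x \<approx> x" and xy: "x * y \<approx> 0" "y * x \<approx> 0"
      using f(2) fg e by (simp_all add: x y uq_cls_simps uq_cls_zero)
    have "free_e t * x * free_e t \<approx> (x + y) * x * (x + y)"
      using e by (simp flip: uq_cls_mult)
    \<comment> \<open>Every term other than \<open>x * x * x\<close> contains a product of the
      orthogonal pair.\<close>
    also have "(x + y) * x * (x + y) = x * x * x + x * (x * y) + y * x * (x + y)"
      by (simp add: algebra_simps)
    also have "\<dots> \<approx> x * x + x * 0 + 0 * (x + y)"
      using xx xy by (intro uq_cls_add_cong uq_cls_mult_left uq_cls_mult_right)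
    finally have x': "free_e t * x * free_e t \<approx> x" using xx by simp
    obtain c where c: "free_e t * x * free_e t \<approx> scale c (free_e t)"
      using free_e_corner [OF t] by blast
    then have xc: "x \<approx> scale c (free_e t)" using x' by simp
    then have "x * x \<approx> scale c (free_e t) * scale c (free_e t)"
      by (simp flip: uq_cls_mult)
    also have "\<dots> = uq_cls p (scale (c * c) (free_e t * free_e t))"
      by (simp add: scale_simps)
    also have "\<dots> = uq_cls p (scale (c * c) (free_e t))"
      using idem by (rule uq_cls_scale_cong)
    finally have "scale (c * c) (free_e t) \<approx> scale c (free_e t)"
      using xx xc by simp
    then have "scale (c * c) (free_e t) - scale c (free_e t) \<approx> scale c (free_e t) - scale c (free_e t)"
      by (rule uq_cls_diff_cong [OF _ refl])
    then have *: "scale (c * c - c) (free_e t) \<approx> 0"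
      by (simp add: scale.scale_left_diff_distrib)
    have "c * c - c = 0"
    proof (rule ccontr)
      assume "c * c - c \<noteq> 0"
      then have "free_e t \<approx> 0"
        using uq_cls_scale_cong [OF *, of "inverse (c * c - c)"] by (simp add: scale_simps)
      with free_e_nonzero [OF t] show False by simp
    qed
    then have "c = 0 \<or> c = 1" by (simp add: algebra_simps)
    then show ?thesis
    proof
      assume "c = 0"
      then show ?thesis using xc by (simp add: x uq_cls_zero)
    next
      assume "c = 1"
      \<comment> \<open>For c = 1 the summand \<open>x\<close> is all of \<open>free_e t\<close>, so
        \<open>y\<close> vanishes.\<close>
      then have "(x + y) - x \<approx> free_e t - free_e t"
        using xc e by (intro uq_cls_diff_cong) simp_all
      then show ?thesis by (simp add: y uq_cls_zero)
    qed
  qed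
  then show ?thesis
    using idem free_e_nonzero [OF t] free_e_in_Q_space [OF t s]
    unfolding primitive_idempotent_def idempotent_in_def e_elt_eq
    by (simp add: Q_def uq_cls_mult uq_cls_zero)
qed

end

theorem proposition4p7:
  fixes p :: nat
  assumes "p \<ge> 2"
  shows "(\<forall>\<alpha>\<in>{1, -1}. \<forall>t1\<in>{1..p}. \<forall>t2\<in>{1..p}.
            e_elt p \<alpha> t1 \<otimes>\<^bsub>Uq p\<^esub> e_elt p \<alpha> t2 =
              (if t1 = t2 then e_elt p \<alpha> t2 else \<zero>\<^bsub>Uq p\<^esub>)) \<and>
         (\<forall>t\<in>{1..p}. primitive_idempotent (Q p p) (e_elt p 1 t) \<and>
                     primitive_idempotent (Q p 0) (e_elt p (-1) t))"
proof (intro conjI ballI)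
  fix \<alpha> :: complex and t1 t2
  assume "\<alpha> \<in> {1, -1}" and t: "t1 \<in> {1..p}" "t2 \<in> {1..p}"
  with assms interpret signed_parameter p \<alpha> by unfold_locales
  show "e_elt p \<alpha> t1 \<otimes>\<^bsub>Uq p\<^esub> e_elt p \<alpha> t2 =
      (if t1 = t2 then e_elt p \<alpha> t2 else \<zero>\<^bsub>Uq p\<^esub>)"
    using free_e_mult_free_e [of t1 t2] t by (simp add: e_elt_eq uq_cls_mult uq_cls_zero)
next
  fix t assume t: "t \<in> {1..p}"
  have plus: "signed_parameter p 1" and minus: "signed_parameter p (- 1)"
    using assms by unfold_locales auto
  show "primitive_idempotent (Q p p) (e_elt p 1 t)"
    using signed_parameter.primitive_idempotent_free_e [OF plus] t by simp
  show "primitive_idempotent (Q p 0) (e_elt p (-1) t)"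
    using signed_parameter.primitive_idempotent_free_e [OF minus] t by simp
qed

end
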